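(* Let $X$ be a Tychonoff space, let $E$ be a dense sublattice of $C_b(X)$, let $U\subset X$ be an open neighborhood of a compact set $K\subset X$, and let $f\in E_+$. Then there is $e\in E$ with $0\le e\le f$ which coincides with $f$ on $K$ and vanishes outside of $U$; there is also $e'\in E$ with $0\le e'\le f$ which vanishes on $K$ and coincides with $f$ outside of $U$. If additionally $X$ is normal, or $K=U$, then the same conclusions hold when $K$ is merely assumed to be closed (instead of compact).
   Context: $C_b(X)$ is the Banach lattice of all bounded continuous real-valued functions on $X$ with pointwise operations and the supremum norm; "dense" means norm dense. A sublattice is a linear subspace closed under the pointwise lattice operations. $E_+=\{f\in E: f\ge0\}$. *)

theory Defs
  imports "HOL-Analysis.Analysis"
begin

definition tychonoff_space :: "'a topology \<Rightarrow> bool" where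
  "tychonoff_space X \<longleftrightarrow> completely_regular_space X \<and> Hausdorff_space X"

text \<open>The Banach lattice of bounded continuous real functions on a space is the library type
  of bounded continuous functions with its supremum norm. The library provides its normed
  vector space structure, but not its order and lattice operations.\<close>

definition sup_bcontfun ::
  "('a::topological_space \<Rightarrow>\<^sub>C real) \<Rightarrow> ('a \<Rightarrow>\<^sub>C real) \<Rightarrow> ('a \<Rightarrow>\<^sub>C real)" where
  "sup_bcontfun f g = Bcontfun (\<lambda>x. max (f x) (g x))"

lemma apply_sup_bcontfun [simp]: "sup_bcontfun f g x = max (f x) (g x)"
proof -
  obtain a b where ab: "\<And>x. \<bar>f x\<bar> \<le> a" "\<And>x. \<bar>g x\<bar> \<le> b"
    using bounded_apply_bcontfun[of f] bounded_apply_bcontfun[of g]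
    by (auto simp: bounded_iff)
  have "\<bar>max (f x) (g x)\<bar> \<le> max a b" for x
    using ab[of x] by (auto simp: max_def max_def)
  then have "(\<lambda>x. max (f x) (g x)) \<in> bcontfun"
    by (auto simp: bcontfun_def bounded_iff intro!: continuous_on_max)
  then show ?thesis
    by (simp add: sup_bcontfun_def Bcontfun_inverse)
qed

definition inf_bcontfun ::
  "('a::topological_space \<Rightarrow>\<^sub>C real) \<Rightarrow> ('a \<Rightarrow>\<^sub>C real) \<Rightarrow> ('a \<Rightarrow>\<^sub>C real)" where
  "inf_bcontfun f g = Bcontfun (\<lambda>x. min (f x) (g x))"

lemma apply_inf_bcontfun [simp]: "inf_bcontfun f g x = min (f x) (g x)"
proof -
  obtain a b where ab: "\<And>x. \<bar>f x\<bar> \<le> a" "\<And>x. \<bar>g x\<bar> \<le> b"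
    using bounded_apply_bcontfun[of f] bounded_apply_bcontfun[of g]
    by (auto simp: bounded_iff)
  have "\<bar>min (f x) (g x)\<bar> \<le> max a b" for x
    using ab[of x] by (auto simp: min_def max_def)
  then have "(\<lambda>x. min (f x) (g x)) \<in> bcontfun"
    by (auto simp: bcontfun_def bounded_iff intro!: continuous_on_min)
  then show ?thesis
    by (simp add: inf_bcontfun_def Bcontfun_inverse)
qed

definition le_bcontfun :: "('a::topological_space \<Rightarrow>\<^sub>C real) \<Rightarrow> ('a \<Rightarrow>\<^sub>C real) \<Rightarrow> bool"
    (infix \<open>\<le>\<^sub>C\<close> 50) where
  "f \<le>\<^sub>C g \<longleftrightarrow> (\<forall>x. f x \<le> g x)"

definition sublattice :: "('a::topological_space \<Rightarrow>\<^sub>C real) set \<Rightarrow> bool" where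
  "sublattice E \<longleftrightarrow> subspace E \<and>
     (\<forall>f\<in>E. \<forall>g\<in>E. sup_bcontfun f g \<in> E \<and> inf_bcontfun f g \<in> E)"

definition positive_part :: "('a::topological_space \<Rightarrow>\<^sub>C real) set \<Rightarrow> ('a \<Rightarrow>\<^sub>C real) set" where
  "positive_part E = {f \<in> E. 0 \<le>\<^sub>C f}"

end

theory Submission
  imports Defs
begin

text \<open>The point is that a sublattice need not contain any of the functions that Urysohn's lemma
  provides, but lattice operations forgive a uniform error. Let \<open>b\<close> be an upper bound of \<open>f\<close> and
  take a continuous function \<open>\<phi>\<close> with the constant value \<open>b + 1\<close> on \<open>K\<close> and \<open>- 1\<close> outside \<open>U\<close>. A
  member \<open>g\<close> of the dense sublattice within distance 1 of \<open>\<phi>\<close> still dominates \<open>f\<close> on \<open>K\<close> and is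
  still nonpositive outside \<open>U\<close>, so truncating it to the order interval between \<open>0\<close> and \<open>f\<close> yields
  exactly \<open>f\<close> on \<open>K\<close> and exactly \<open>0\<close> outside \<open>U\<close>. If \<open>e\<close> is this truncation, then \<open>f - e\<close> has
  the complementary behaviour.

  Compactness, normality and the equation \<open>K = U\<close> are three reasons for \<open>\<phi>\<close> to exist
  (\<open>obtain_bcontfun_separating\<close>); from then on the argument is the same in all cases
  (\<open>truncation_in_dense_sublattice\<close>).\<close>

text \<open>In the compact and the normal case this is Urysohn's lemma. A closed set with \<open>K = U\<close> is
  clopen, so the function with the value \<open>b\<close> on \<open>K\<close> and \<open>a\<close> elsewhere is already continuous.\<close>

lemma obtain_bcontfun_separating:
  fixes K U :: "'a::topological_space set" and a b :: real
  assumes creg: "completely_regular_space (euclidean :: 'a topology)"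
    and "open U" "K \<subseteq> U" "a \<le> b"
    and cases: "compact K \<or> closed K \<and> (normal_space (euclidean :: 'a topology) \<or> K = U)"
  obtains \<phi> :: "'a \<Rightarrow>\<^sub>C real" where "\<And>x. x \<in> K \<Longrightarrow> \<phi> x = b" "\<And>x. x \<notin> U \<Longrightarrow> \<phi> x = a"
proof -
  have "closedin euclidean (- U)" "disjnt K (- U)" "disjnt (- U) K"
    using assms by (auto simp: disjnt_def)
  then have "\<exists>h. continuous_on UNIV h \<and> range h \<subseteq> {a..b} \<and> h ` K \<subseteq> {b} \<and> h ` (- U) \<subseteq> {a}"
  proof -
    consider "compact K" | "closed K" "normal_space (euclidean :: 'a topology)" | "closed K" "K = U"
      using cases by blast
    then show ?thesis
    proof cases
      case 1
      then obtain h where "continuous_map euclidean (top_of_set {a..b}) h"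
          "h ` (- U) \<subseteq> {a}" "h ` K \<subseteq> {b}"
        using Urysohn_completely_regular_compact_closed[OF \<open>a \<le> b\<close> creg, of K "- U"]
          \<open>closedin euclidean (- U)\<close> \<open>disjnt K (- U)\<close> by auto
      then show ?thesis
        by (auto simp: continuous_map_in_subtopology)
    next
      case 2
      then obtain h where "continuous_map euclidean (top_of_set {a..b}) h"
          "h ` (- U) \<subseteq> {a}" "h ` K \<subseteq> {b}"
        using Urysohn_lemma[of euclidean "- U" K a b] \<open>a \<le> b\<close>
          \<open>closedin euclidean (- U)\<close> \<open>disjnt (- U) K\<close> by auto
      then show ?thesis
        by (auto simp: continuous_map_in_subtopology)
    next
      case 3
      have "continuous_on (K \<union> - K) (\<lambda>x. if x \<in> K then b else a)"
        using 3 \<open>open U\<close> by (intro continuous_on_If) auto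
      then show ?thesis
        using 3 \<open>a \<le> b\<close> by (intro exI[of _ "\<lambda>x. if x \<in> K then b else a"]) auto
    qed
  qed
  then obtain h where h: "continuous_on UNIV h" "range h \<subseteq> {a..b}" "h ` K \<subseteq> {b}" "h ` (- U) \<subseteq> {a}"
    by blast
  then have "h \<in> bcontfun"
    using bounded_subset[OF bounded_closed_interval] by (auto simp: bcontfun_def)
  then obtain \<phi> :: "'a \<Rightarrow>\<^sub>C real" where "h = \<phi>"
    by (rule bcontfunE)
  with h show thesis
    by (intro that[of \<phi>]) auto
qed

text \<open>The margins of 1 in the hypotheses on \<open>\<phi>\<close> absorb the error of an approximation of \<open>\<phi>\<close>
  by a member of \<open>E\<close>, so that \<open>f\<close> and \<open>0\<close> are attained exactly.\<close>

lemma truncation_in_dense_sublattice: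
  fixes f \<phi> :: "'a::topological_space \<Rightarrow>\<^sub>C real"
  assumes E: "sublattice E" and dense: "closure E = UNIV" and f: "f \<in> positive_part E"
    and large: "\<And>x. x \<in> A \<Longrightarrow> f x + 1 \<le> \<phi> x"
    and small: "\<And>x. x \<in> B \<Longrightarrow> \<phi> x \<le> - 1"
  obtains e where "e \<in> E" "0 \<le>\<^sub>C e" "e \<le>\<^sub>C f"
    "\<And>x. x \<in> A \<Longrightarrow> e x = f x" "\<And>x. x \<in> B \<Longrightarrow> e x = 0"
proof -
  obtain g where "g \<in> E" "dist g \<phi> < 1"
    using dense closure_approachable[of \<phi> E] by (metis UNIV_I zero_less_one)
  then have near: "\<bar>g x - \<phi> x\<bar> < 1" for x
    using dist_fun_lt_imp_dist_val_lt[of g \<phi> 1 x] by (simp add: dist_real_def)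
  have f_nonneg: "0 \<le> f x" for x
    using f by (auto simp: positive_part_def le_bcontfun_def)
  define e where "e = inf_bcontfun (sup_bcontfun g 0) f"
  show thesis
  proof
    show "e \<in> E"
      using E f \<open>g \<in> E\<close>
      by (auto simp: e_def sublattice_def positive_part_def subspace_0)
    show "0 \<le>\<^sub>C e" "e \<le>\<^sub>C f"
      using f_nonneg by (auto simp: e_def le_bcontfun_def)
    show "e x = f x" if "x \<in> A" for x
      using near[of x] large[OF that] by (simp add: e_def)
    show "e x = 0" if "x \<in> B" for x
      using near[of x] small[OF that] f_nonneg[of x] by (simp add: e_def)
  qed
qed

theorem proposition2p1:
  fixes E :: "('a::topological_space \<Rightarrow>\<^sub>C real) set"
    and f :: "'a \<Rightarrow>\<^sub>C real"
    and K U :: "'a set"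
  assumes "tychonoff_space (euclidean :: 'a topology)"
    and "sublattice E"
    and "closure E = UNIV"
    and "open U"
    and "K \<subseteq> U"
    and "compact K \<or> closed K \<and> (normal_space (euclidean :: 'a topology) \<or> K = U)"
    and "f \<in> positive_part E"
  shows "(\<exists>e\<in>E. 0 \<le>\<^sub>C e \<and> e \<le>\<^sub>C f \<and> (\<forall>x\<in>K. e x = f x) \<and> (\<forall>x. x \<notin> U \<longrightarrow> e x = 0)) \<and>
         (\<exists>e'\<in>E. 0 \<le>\<^sub>C e' \<and> e' \<le>\<^sub>C f \<and> (\<forall>x\<in>K. e' x = 0) \<and> (\<forall>x. x \<notin> U \<longrightarrow> e' x = f x))"
proof -
  have creg: "completely_regular_space (euclidean :: 'a topology)"
    using assms(1) by (simp add: tychonoff_space_def)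
  have order: "(- 1 :: real) \<le> norm f + 1"
    using norm_ge_zero[of f] by linarith
  obtain \<phi> :: "'a \<Rightarrow>\<^sub>C real" where \<phi>: "\<And>x. x \<in> K \<Longrightarrow> \<phi> x = norm f + 1" "\<And>x. x \<notin> U \<Longrightarrow> \<phi> x = - 1"
    by (rule obtain_bcontfun_separating[OF creg assms(4,5) order assms(6)]) blast
  have "f x + 1 \<le> \<phi> x" if "x \<in> K" for x
    using \<phi>(1)[OF that] norm_bounded[of f x] by simp
  moreover have "\<phi> x \<le> - 1" if "x \<in> - U" for x
    using \<phi>(2) that by simp
  ultimately obtain e where e: "e \<in> E" "0 \<le>\<^sub>C e" "e \<le>\<^sub>C f"
      "\<And>x. x \<in> K \<Longrightarrow> e x = f x" "\<And>x. x \<in> - U \<Longrightarrow> e x = 0"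
    by (rule truncation_in_dense_sublattice[OF assms(2,3,7)]) blast+
  have "f - e \<in> E"
    using assms(2,7) \<open>e \<in> E\<close> by (auto simp: sublattice_def positive_part_def intro: subspace_diff)
  moreover have "0 \<le>\<^sub>C f - e" "f - e \<le>\<^sub>C f"
    using e(2,3) by (auto simp: le_bcontfun_def)
  ultimately show ?thesis
    using e by (intro conjI bexI[of _ e] bexI[of _ "f - e"]) auto
qed

end
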